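(* Let $f$ be a holomorphic self-map of the open unit disc $\mathbb{D}$ with a Denjoy--Wolff point $\zeta$ in $\mathbb{D}$. Suppose that $f_1,f_2,\dotsc$ is a sequence of holomorphic self-maps of $\mathbb{D}$ that converges locally uniformly on $\mathbb{D}$ to $f$. Then the left-composition sequence $F_n=f_n\circ f_{n-1}\circ\dotsb\circ f_1$, $n=1,2,\dotsc$, converges locally uniformly on $\mathbb{D}$ to $\zeta$.
   Context: $\mathbb{D}=\{z\in\mathbb{C}:|z|<1\}$. A holomorphic self-map of $\mathbb{D}$ is a holomorphic function $\mathbb{D}\to\mathbb{D}$. A holomorphic self-map $f$ of $\mathbb{D}$ has Denjoy--Wolff point $\zeta\in\overline{\mathbb{D}}$ if the sequence of iterates $f,f^2,f^3,\dotsc$ (where $f^n$ is the $n$-fold composition of $f$ with itself) converges locally uniformly on $\mathbb{D}$ to the constant $\zeta$. By the Denjoy--Wolff theorem, every holomorphic self-map of $\mathbb{D}$ other than the identity and the elliptic Möbius transformations fixing $\mathbb{D}$ (automorphisms of $\mathbb{D}$ conjugate by an automorphism of $\mathbb{D}$ to a rotation about $0$) has a Denjoy--Wolff point; if it lies in $\mathbb{D}$ it is a fixed point of the map. Locally uniform convergence on $\mathbb{D}$ means uniform convergence on compact subsets of $\mathbb{D}$ with respect to the Euclidean metric; convergence to $\zeta$ means convergence to the constant function with value $\zeta$. *)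

theory Defs
  imports "HOL-Analysis.Analysis"
begin

text \<open>Maps of the open unit disc are represented by functions on the whole complex plane; only their
  values on the disc are ever constrained or used.\<close>

abbreviation unit_disc :: "complex set" where
  "unit_disc \<equiv> ball 0 1"

definition holomorphic_self_map :: "(complex \<Rightarrow> complex) \<Rightarrow> bool" where
  "holomorphic_self_map f \<longleftrightarrow> f holomorphic_on unit_disc \<and> f ` unit_disc \<subseteq> unit_disc"

definition converges_locally_uniformly ::
    "(nat \<Rightarrow> complex \<Rightarrow> complex) \<Rightarrow> (complex \<Rightarrow> complex) \<Rightarrow> bool" where
  "converges_locally_uniformly g h \<longleftrightarrow>
     (\<forall>K. compact K \<and> K \<subseteq> unit_disc \<longrightarrow> uniform_limit K g h sequentially)"

definition denjoy_wolff_point :: "(complex \<Rightarrow> complex) \<Rightarrow> complex \<Rightarrow> bool" where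
  "denjoy_wolff_point f \<zeta> \<longleftrightarrow>
     \<zeta> \<in> closure unit_disc \<and> converges_locally_uniformly (\<lambda>n. f ^^ n) (\<lambda>_. \<zeta>)"

text \<open>\<open>left_composition f n\<close> is \<open>f n \<circ> \<dots> \<circ> f 1\<close>; the sequence of maps is indexed
  from 1, so \<open>f 0\<close> is not used and the value at \<open>n = 0\<close> is the empty composition.\<close>

primrec left_composition :: "(nat \<Rightarrow> complex \<Rightarrow> complex) \<Rightarrow> nat \<Rightarrow> complex \<Rightarrow> complex" where
  "left_composition f 0 = id"
| "left_composition f (Suc n) = f (Suc n) \<circ> left_composition f n"

end

theory Submission
  imports Defs "HOL-Complex_Analysis.Complex_Analysis"
begin

text \<open>
  A Moebius automorphism of the disc moves \<open>\<zeta>\<close> to the origin, and conjugation by it respects both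
  locally uniform convergence and left compositions, so let \<open>\<zeta> = 0\<close>. Fix a radius \<open>0 < r < 1\<close>.
  The iterates of \<open>f\<close> tend to \<open>0\<close>, so \<open>f\<close> is not a rotation, and the Schwarz lemma makes \<open>f\<close> shrink
  the closed disc of radius \<open>r\<close> into a strictly smaller one. By uniform convergence on that disc,
  there is \<open>\<rho> < r\<close> such that all late \<open>f\<^sub>n\<close> map it into the disc of radius \<open>\<rho>\<close>. Hence an
  orbit that enters it late is trapped there.

  The difficulty is to exclude that orbits drift towards the unit circle, where locally uniform
  convergence gives no control over \<open>f\<^sub>n\<close>. There the maximum principle in the annulus \<open>r \<le> |z| < 1\<close>,
  in the manner of Hadamard's three circles theorem, supplies an estimate with the same constants for
  all late \<open>n\<close>: from \<open>|f\<^sub>n| \<le> \<rho> < r\<close> on the inner circle and \<open>|f\<^sub>n| \<le> 1\<close> near the outer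
  one it follows that \<open>|f\<^sub>n z|\<^sup>q \<le> |z|\<^sup>q\<^sup>+\<^sup>1\<close> in the annulus, for an exponent \<open>q\<close> depending
  only on \<open>r\<close> and \<open>\<rho>\<close>. A point with \<open>r \<le> |z| \<le> s < 1\<close> therefore has its modulus multiplied by at
  most \<open>root q s < 1\<close>. So the late orbits of a compact set enter the disc of radius \<open>r\<close> at a common
  time and stay in it. As \<open>r\<close> is arbitrary, they converge to \<open>0\<close> uniformly on that compact set.
\<close>

section \<open>A growth estimate in an annulus\<close>

lemma frontier_closed_annulus_subset:
  fixes a :: "'a::metric_space"
  shows "frontier (cball a s - ball a r) \<subseteq> sphere a r \<union> sphere a s"
proof -
  have "ball a s - cball a r \<subseteq> interior (cball a s - ball a r)"
    by (rule interior_maximal) (auto simp: open_Diff)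
  moreover have "closure (cball a s - ball a r) = cball a s - ball a r"
    by (simp add: closed_Diff)
  ultimately show ?thesis
    unfolding frontier_def by force
qed

text \<open>The maximum principle is applied to \<open>g\<^sup>q / z\<^sup>p\<close>. The integer exponents keep this function
  single-valued. As \<open>g\<close> need not extend continuously to the unit circle, the outer circle has radius
  \<open>s < 1\<close>, where the bound is \<open>1 / s\<^sup>p\<close>, and then \<open>s\<close> tends to \<open>1\<close>.\<close>

lemma power_bound_on_annulus:
  assumes hol: "g holomorphic_on ball 0 1"
    and bound: "\<And>z. norm z < 1 \<Longrightarrow> norm (g z) \<le> 1"
    and inner: "\<And>z. norm z = r \<Longrightarrow> norm (g z) ^ q \<le> r ^ p"
    and r: "0 < r" and w: "r \<le> norm w" "norm w < 1"
  shows "norm (g w) ^ q \<le> norm w ^ p"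
proof -
  have scaled: "norm (g w) ^ q * s ^ p \<le> norm w ^ p" if s: "norm w < s" "s < 1" for s
  proof -
    let ?A = "cball 0 s - ball 0 r :: complex set"
    let ?h = "\<lambda>z. g z ^ q / z ^ p"
    have s0: "0 < s"
      using r w s by linarith
    have A: "closure ?A = ?A"
      by (simp add: closed_Diff)
    have holh: "?h holomorphic_on ?A"
      using r s by (intro holomorphic_intros holomorphic_on_subset[OF hol]) auto
    have "norm (?h w) \<le> 1 / s ^ p"
    proof (rule maximum_modulus_frontier[of ?h ?A])
      show "?h holomorphic_on interior ?A"
        using holh interior_subset by (rule holomorphic_on_subset)
      show "continuous_on (closure ?A) ?h"
        unfolding A using holh by (rule holomorphic_on_imp_continuous_on)
      show "norm (?h z) \<le> 1 / s ^ p" if z: "z \<in> frontier ?A" for z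
      proof -
        consider "norm z = r" | "norm z = s"
          using subsetD[OF frontier_closed_annulus_subset z] by auto
        then show ?thesis
        proof cases
          case 1
          then have "norm (?h z) \<le> 1"
            using inner r by (simp add: norm_divide norm_power)
          moreover have "s ^ p \<le> 1"
            using s s0 by (simp add: power_le_one)
          ultimately show ?thesis
            using s0 by (simp add: field_simps mult_le_one order_trans[of _ "1"])
        next
          case 2
          then show ?thesis
            using bound[of z] s s0 by (simp add: norm_divide norm_power power_le_one divide_right_mono)
        qed
      qed
    qed (use s w in auto)
    moreover have "0 < norm w"
      using r w by linarith
    ultimately show ?thesis
      using s0 by (simp add: norm_divide norm_power divide_simps mult.commute)
  qed
  have "((\<lambda>s. norm (g w) ^ q * s ^ p) \<longlongrightarrow> norm (g w) ^ q * 1 ^ p) (at_left 1)"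
    by (intro tendsto_intros)
  moreover have "\<forall>\<^sub>F s in at_left 1. norm (g w) ^ q * s ^ p \<le> norm w ^ p"
    using w scaled by (auto simp: eventually_at_left_field)
  ultimately have "norm (g w) ^ q * 1 ^ p \<le> norm w ^ p"
    by (intro tendsto_upperbound) auto
  then show ?thesis
    by simp
qed

text \<open>The constant \<open>\<sigma>\<close> depends on the radii only, so it serves all maps of a sequence at once. It is
  \<open>root q s\<close>, where \<open>q\<close> satisfies \<open>(\<rho> / r)\<^sup>q \<le> r\<close>, that is, \<open>\<rho>\<^sup>q \<le> r\<^sup>q\<^sup>+\<^sup>1\<close>: the annulus estimate
  then gives \<open>|g w|\<^sup>q \<le> |w|\<^sup>q |w| \<le> |w|\<^sup>q s\<close>.\<close>

lemma uniform_contraction_outside_cball: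
  fixes \<rho> r s :: real
  assumes radii: "0 \<le> \<rho>" "\<rho> < r" "r < s" "s < 1"
  obtains \<sigma> where "0 \<le> \<sigma>" "\<sigma> < 1"
    "\<And>g w. \<lbrakk>holomorphic_self_map g; g ` cball 0 r \<subseteq> cball 0 \<rho>; r \<le> norm w; norm w \<le> s\<rbrakk>
       \<Longrightarrow> norm (g w) \<le> \<sigma> * norm w"
proof -
  have r: "0 < r"
    using radii by linarith
  obtain n where n: "(\<rho> / r) ^ n < r"
    using real_arch_pow_inv[of r "\<rho> / r"] radii r by auto
  define q where "q = Suc n"
  have q: "0 < q"
    by (simp add: q_def)
  have "(\<rho> / r) ^ q \<le> (\<rho> / r) ^ n"
    unfolding q_def using radii r by (intro power_decreasing) auto
  with n have "(\<rho> / r) ^ q \<le> r"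
    by linarith
  then have \<rho>q: "\<rho> ^ q \<le> r ^ Suc q"
    using r by (simp add: power_divide pos_divide_le_eq)
  show ?thesis
  proof (rule that[of "root q s"])
    show "0 \<le> root q s" "root q s < 1"
      using q radii r by auto
    fix g :: "complex \<Rightarrow> complex" and w :: complex
    assume g: "holomorphic_self_map g" "g ` cball 0 r \<subseteq> cball 0 \<rho>"
      and w: "r \<le> norm w" "norm w \<le> s"
    have "norm (g w) ^ q \<le> norm w ^ Suc q"
    proof (rule power_bound_on_annulus)
      show "g holomorphic_on ball 0 1"
        using g(1) by (simp add: holomorphic_self_map_def)
      show "norm (g z) \<le> 1" if "norm z < 1" for z
        using g(1) that by (force simp: holomorphic_self_map_def)
      show "norm (g z) ^ q \<le> r ^ Suc q" if "norm z = r" for z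
      proof -
        have "norm (g z) ^ q \<le> \<rho> ^ q"
          using g(2) that by (intro power_mono) (auto simp: image_subset_iff)
        then show ?thesis
          using \<rho>q by linarith
      qed
    qed (use r w radii in auto)
    also have "\<dots> \<le> s * norm w ^ q"
      using w by (simp add: mult_right_mono)
    also have "\<dots> = (root q s * norm w) ^ q"
      using q radii r by (simp add: power_mult_distrib)
    finally show "norm (g w) \<le> root q s * norm w"
      using q radii r by (simp add: power_mono_iff)
  qed
qed

section \<open>A limit map that fixes the origin\<close>

lemma holomorphic_self_map_id: "holomorphic_self_map id"
  by (auto simp: holomorphic_self_map_def id_def)

lemma holomorphic_self_map_comp:
  assumes "holomorphic_self_map f" "holomorphic_self_map g"
  shows "holomorphic_self_map (f \<circ> g)"
  using assms holomorphic_on_compose_gen[of g unit_disc f unit_disc]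
  unfolding holomorphic_self_map_def by (auto simp: image_subset_iff)

lemma norm_holomorphic_self_map_less:
  assumes "holomorphic_self_map g" "norm z < 1"
  shows "norm (g z) < 1"
  using assms by (force simp: holomorphic_self_map_def)

lemma holomorphic_self_map_left_composition:
  assumes "\<And>n. n \<ge> 1 \<Longrightarrow> holomorphic_self_map (fs n)"
  shows "holomorphic_self_map (left_composition fs n)"
proof (induction n)
  case 0
  show ?case
    using holomorphic_self_map_id by (simp only: left_composition.simps)
next
  case (Suc n)
  then show ?case
    using holomorphic_self_map_comp[OF assms] by (simp only: left_composition.simps)
qed

lemma left_composition_const: "left_composition (\<lambda>_. f) n = f ^^ n"
  by (induction n) auto

text \<open>Equality in the Schwarz lemma would make \<open>g\<close> a rotation, whose orbits stay on circles.\<close>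

lemma norm_less_if_iterates_tendsto_0:
  assumes g: "holomorphic_self_map g" "g 0 = 0"
    and iter: "\<And>z. norm z < 1 \<Longrightarrow> (\<lambda>n. (g ^^ n) z) \<longlonglongrightarrow> 0"
    and z: "norm z < 1" "z \<noteq> 0"
  shows "norm (g z) < norm z"
proof (rule ccontr)
  have hol: "g holomorphic_on ball 0 1"
    using g(1) by (simp add: holomorphic_self_map_def)
  note Schwarz = Schwarz_Lemma[OF hol g(2) norm_holomorphic_self_map_less[OF g(1)] z(1)]
  assume "\<not> norm (g z) < norm z"
  with Schwarz(1) have "norm (g z) = norm z"
    by linarith
  with Schwarz(3) z obtain \<alpha> where \<alpha>: "\<And>w. norm w < 1 \<Longrightarrow> g w = \<alpha> * w" "norm \<alpha> = 1"
    by metis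
  have "norm ((g ^^ n) z) = norm z" for n
    by (induction n) (use \<alpha> z in \<open>auto simp: norm_mult\<close>)
  then have "(\<lambda>n. norm z) \<longlonglongrightarrow> 0"
    using tendsto_norm_zero[OF iter[OF z(1)]] by simp
  with z(2) show False
    by (simp add: LIMSEQ_const_iff)
qed

text \<open>Every late map sends a point \<open>w\<close> with \<open>|w| \<le> s\<close> either into the disc of radius \<open>r\<close> or to a
  point of modulus at most \<open>\<sigma> |w|\<close>. The radius \<open>s\<close> is chosen only after the time \<open>N\<close> from which on the maps
  are close to \<open>g\<close>, large enough to contain the image of the compact set at time \<open>N\<close>.\<close>

lemma left_composition_tendsto_0:
  assumes g: "holomorphic_self_map g"
    and shrink: "\<And>z. \<lbrakk>norm z < 1; z \<noteq> 0\<rbrakk> \<Longrightarrow> norm (g z) < norm z" and g0: "g 0 = 0"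
    and gs: "\<And>n. n \<ge> 1 \<Longrightarrow> holomorphic_self_map (gs n)"
    and conv: "converges_locally_uniformly gs g"
  shows "converges_locally_uniformly (left_composition gs) (\<lambda>_. 0)"
  unfolding converges_locally_uniformly_def
proof (intro allI impI, elim conjE)
  fix K :: "complex set"
  assume K: "compact K" "K \<subseteq> unit_disc"
  let ?F = "left_composition gs"
  have late: "\<forall>\<^sub>F n in sequentially. \<forall>z\<in>K. norm (?F n z) \<le> r" if r: "0 < r" "r < 1" for r :: real
  proof -
    have sub: "cball 0 r \<subseteq> unit_disc"
      using r by auto
    have contg: "continuous_on (cball 0 r) (\<lambda>z. norm (g z))"
      using g sub by (intro continuous_intros holomorphic_on_imp_continuous_on)
        (auto simp: holomorphic_self_map_def intro: holomorphic_on_subset)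
    obtain x where x: "x \<in> cball 0 r" "\<And>z. z \<in> cball 0 r \<Longrightarrow> norm (g z) \<le> norm (g x)"
      using continuous_attains_sup[OF compact_cball _ contg] r by fastforce
    have "norm (g x) < r"
      using shrink[of x] g0 x(1) r by (cases "x = 0") auto
    then obtain \<rho> where \<rho>: "norm (g x) < \<rho>" "\<rho> < r"
      using dense by blast
    have "uniform_limit (cball 0 r) gs g sequentially"
      using conv sub by (simp add: converges_locally_uniformly_def)
    then have "\<forall>\<^sub>F n in sequentially. \<forall>z\<in>cball 0 r. dist (gs n z) (g z) < \<rho> - norm (g x)"
      by (rule uniform_limitD) (use \<rho> in simp)
    then obtain N0 where N0: "\<And>n z. \<lbrakk>n \<ge> N0; z \<in> cball 0 r\<rbrakk> \<Longrightarrow> dist (gs n z) (g z) < \<rho> - norm (g x)"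
      unfolding eventually_sequentially by blast
    have into: "gs n ` cball 0 r \<subseteq> cball 0 \<rho>" if "n \<ge> N0" for n
    proof clarify
      fix z :: complex
      assume z: "z \<in> cball 0 r"
      show "gs n z \<in> cball 0 \<rho>"
        using N0[OF that z] x(2)[OF z] norm_triangle_sub[of "gs n z" "g z"] by (simp add: dist_norm)
    qed
    define N where "N = N0 + 1"
    have FN: "holomorphic_self_map (?F N)"
      by (rule holomorphic_self_map_left_composition[OF gs])
    obtain s where s: "r < s" "s < 1" "\<And>z. z \<in> K \<Longrightarrow> norm (?F N z) \<le> s"
    proof (cases "K = {}")
      case True
      with r dense that show ?thesis
        by blast
    next
      case False
      have contF: "continuous_on K (\<lambda>z. norm (?F N z))"
        using FN K by (intro continuous_intros holomorphic_on_imp_continuous_on)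
          (auto simp: holomorphic_self_map_def intro: holomorphic_on_subset)
      obtain y where y: "y \<in> K" "\<And>z. z \<in> K \<Longrightarrow> norm (?F N z) \<le> norm (?F N y)"
        using continuous_attains_sup[OF K(1) False contF] by blast
      have "norm (?F N y) < 1"
        using norm_holomorphic_self_map_less[OF FN] y(1) K(2) by auto
      with r obtain s where "max r (norm (?F N y)) < s" "s < 1"
        using dense[of "max r (norm (?F N y))" 1] by auto
      with y(2) show ?thesis
        by (intro that[of s]) force+
    qed
    have "0 \<le> \<rho>"
      using \<rho>(1) norm_ge_zero[of "g x"] by linarith
    then obtain \<sigma> where \<sigma>: "0 \<le> \<sigma>" "\<sigma> < 1"
      "\<And>h w. \<lbrakk>holomorphic_self_map h; h ` cball 0 r \<subseteq> cball 0 \<rho>; r \<le> norm w; norm w \<le> s\<rbrakk>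
         \<Longrightarrow> norm (h w) \<le> \<sigma> * norm w"
      using uniform_contraction_outside_cball \<rho>(2) s(1,2) by metis
    have step: "norm (gs n w) \<le> max r (\<sigma> * norm w)" if n: "n \<ge> N" and w: "norm w \<le> s" for n w
    proof (cases "norm w \<le> r")
      case True
      then have "gs n w \<in> cball 0 \<rho>"
        using into[of n] n by (auto simp: N_def image_subset_iff)
      with \<rho>(2) show ?thesis
        by simp
    next
      case False
      with \<sigma>(3)[of "gs n" w] gs[of n] into[of n] n w show ?thesis
        by (auto simp: N_def)
    qed
    have orbit: "norm (?F (N + j) z) \<le> max r (\<sigma> ^ j * s)" if z: "z \<in> K" for j z
    proof (induction j)
      case 0
      with s(3)[OF z] show ?case
        by simp
    next
      case (Suc j)
      let ?w = "?F (N + j) z"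
      have "\<sigma> ^ j * s \<le> s"
        using \<sigma> s r by (simp add: mult_left_le_one_le power_le_one)
      with Suc s(1) have "norm ?w \<le> s"
        by linarith
      then have "norm (?F (N + Suc j) z) \<le> max r (\<sigma> * norm ?w)"
        using step[of "Suc (N + j)" ?w] by simp
      moreover have "\<sigma> * norm ?w \<le> \<sigma> * max r (\<sigma> ^ j * s)"
        using Suc \<sigma>(1) by (rule mult_left_mono)
      moreover have "\<sigma> * max r (\<sigma> ^ j * s) \<le> max r (\<sigma> ^ Suc j * s)"
        using \<sigma>(1,2) r mult_left_le_one_le[of r \<sigma>]
          max.mono[of "\<sigma> * r" r "\<sigma> * (\<sigma> ^ j * s)" "\<sigma> ^ Suc j * s"]
        by (simp add: max_mult_distrib_left mult.assoc)
      ultimately show ?case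
        by linarith
    qed
    have "(\<lambda>j. \<sigma> ^ j * s) \<longlonglongrightarrow> 0 * s"
      using \<sigma>(1,2) by (intro tendsto_intros LIMSEQ_realpow_zero) auto
    then have "\<forall>\<^sub>F j in sequentially. \<sigma> ^ j * s < r"
      using r by (intro order_tendstoD(2)[where y = "0 * s"]) auto
    then have "\<forall>\<^sub>F j in sequentially. \<forall>z\<in>K. norm (?F (j + N) z) \<le> r"
    proof eventually_elim
      case (elim j)
      with orbit[of _ j] show ?case
        by (fastforce simp: add.commute)
    qed
    then show ?thesis
      by (rule iffD1[OF eventually_sequentially_seg])
  qed
  show "uniform_limit K ?F (\<lambda>_. 0) sequentially"
  proof (rule uniform_limitI)
    fix e :: real
    assume "0 < e"
    then have "\<forall>\<^sub>F n in sequentially. \<forall>z\<in>K. norm (?F n z) \<le> min (e / 2) (1 / 2)"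
      by (intro late) auto
    then show "\<forall>\<^sub>F n in sequentially. \<forall>z\<in>K. dist (?F n z) 0 < e"
      by eventually_elim (use \<open>0 < e\<close> in force)
  qed
qed

section \<open>Conjugation by Moebius automorphisms\<close>

definition moebius_conj :: "complex \<Rightarrow> (complex \<Rightarrow> complex) \<Rightarrow> complex \<Rightarrow> complex" where
  "moebius_conj a h = Moebius_function 0 a \<circ> h \<circ> Moebius_function 0 (- a)"

lemma holomorphic_self_map_Moebius:
  assumes "norm a < 1"
  shows "holomorphic_self_map (Moebius_function 0 a)"
  using assms Moebius_function_holomorphic Moebius_function_norm_lt_1
  by (auto simp: holomorphic_self_map_def)

lemma holomorphic_self_map_moebius_conj:
  assumes "norm a < 1" "holomorphic_self_map h"
  shows "holomorphic_self_map (moebius_conj a h)"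
  unfolding moebius_conj_def
  using assms by (intro holomorphic_self_map_comp holomorphic_self_map_Moebius) auto

lemma moebius_conj_at_inverse:
  assumes "norm a < 1" "norm z < 1"
  shows "moebius_conj a h (Moebius_function 0 a z) = Moebius_function 0 a (h z)"
  using assms Moebius_function_compose[of "- a" a z] by (simp add: moebius_conj_def)

lemma moebius_conj_inverse:
  assumes "norm a < 1" "norm z < 1" "holomorphic_self_map h"
  shows "moebius_conj (- a) (moebius_conj a h) z = h z"
proof -
  have "norm (h z) < 1"
    using assms by (simp add: norm_holomorphic_self_map_less)
  then show ?thesis
    using assms Moebius_function_compose[of "- a" a] by (simp add: moebius_conj_def)
qed

text \<open>The automorphism is continuous up to the unit circle, its pole lying outside the closed disc,
  and the closed disc is compact.\<close>

lemma uniformly_continuous_on_Moebius: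
  assumes "norm a < 1"
  shows "uniformly_continuous_on unit_disc (Moebius_function 0 a)"
proof -
  have "1 - cnj a * z \<noteq> 0" if "norm z \<le> 1" for z
  proof -
    have "norm (cnj a * z) \<le> norm a"
      using that by (simp add: norm_mult mult_left_le)
    with assms show ?thesis
      by auto
  qed
  then have "continuous_on (cball 0 1) (Moebius_function 0 a)"
    unfolding Moebius_function_simple by (intro continuous_intros) auto
  then have "uniformly_continuous_on (cball 0 1) (Moebius_function 0 a)"
    by (rule compact_uniformly_continuous) simp
  then show ?thesis
    unfolding uniformly_continuous_on_def by (meson ball_subset_cball subsetD)
qed

lemma converges_locally_uniformly_moebius_conj:
  assumes a: "norm a < 1"
    and h: "\<And>n. n \<ge> 1 \<Longrightarrow> h n ` unit_disc \<subseteq> unit_disc" "l ` unit_disc \<subseteq> unit_disc"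
    and conv: "converges_locally_uniformly h l"
  shows "converges_locally_uniformly (\<lambda>n. moebius_conj a (h n)) (moebius_conj a l)"
  unfolding converges_locally_uniformly_def
proof (intro allI impI, elim conjE)
  fix K :: "complex set"
  assume K: "compact K" "K \<subseteq> unit_disc"
  let ?M = "Moebius_function 0 a" and ?M' = "Moebius_function 0 (- a)"
  have M': "holomorphic_self_map ?M'"
    using a by (simp add: holomorphic_self_map_Moebius)
  have sub: "?M' ` K \<subseteq> unit_disc"
    using M' K(2) by (auto simp: holomorphic_self_map_def)
  have "continuous_on K ?M'"
    using M' K(2) by (meson holomorphic_self_map_def holomorphic_on_imp_continuous_on
        continuous_on_subset)
  then have "compact (?M' ` K)"
    using K(1) by (rule compact_continuous_image)
  then have "uniform_limit (?M' ` K) h l sequentially"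
    using conv sub by (simp add: converges_locally_uniformly_def)
  then have "uniform_limit (?M' ` K) (\<lambda>n z. ?M (h n z)) (?M \<circ> l) sequentially"
  proof (rule uniform_limit_compose[OF _ uniformly_continuous_on_Moebius[OF a]])
    show "\<forall>\<^sub>F n in sequentially. h n ` ?M' ` K \<subseteq> unit_disc"
      using eventually_ge_at_top[of 1] by eventually_elim (use h(1) sub in blast)
    show "l ` ?M' ` K \<subseteq> unit_disc"
      using h(2) sub by blast
  qed
  from uniform_limit_compose'[OF this, of ?M' K]
  show "uniform_limit K (\<lambda>n. moebius_conj a (h n)) (moebius_conj a l) sequentially"
    by (simp add: moebius_conj_def o_def)
qed

text \<open>The inner automorphisms cancel only inside the disc, where all partial compositions take their
  values; on the rest of the plane the two sides may differ.\<close>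

lemma left_composition_moebius_conj:
  assumes a: "norm a < 1" and z: "norm z < 1"
    and fs: "\<And>n. n \<ge> 1 \<Longrightarrow> holomorphic_self_map (fs n)"
  shows "left_composition (\<lambda>n. moebius_conj a (fs n)) n z = moebius_conj a (left_composition fs n) z"
proof (induction n)
  case 0
  show ?case
    using a z Moebius_function_compose[of a "- a" z] by (simp add: moebius_conj_def)
next
  case (Suc n)
  let ?F = "left_composition fs n" and ?w = "Moebius_function 0 (- a) z"
  have "norm ?w < 1"
    using a z by (simp add: Moebius_function_norm_lt_1)
  then have "norm (?F ?w) < 1"
    using holomorphic_self_map_left_composition[of fs, OF fs] norm_holomorphic_self_map_less by blast
  with Suc show ?case
    using moebius_conj_at_inverse[OF a, of "?F ?w" "fs (Suc n)"] by (simp add: moebius_conj_def)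
qed

lemma converges_locally_uniformly_cong:
  assumes "\<And>n z. norm z < 1 \<Longrightarrow> g n z = g' n z" "\<And>z. norm z < 1 \<Longrightarrow> h z = h' z"
  shows "converges_locally_uniformly g h \<longleftrightarrow> converges_locally_uniformly g' h'"
proof -
  have "uniform_limit K g h sequentially \<longleftrightarrow> uniform_limit K g' h' sequentially"
    if "K \<subseteq> unit_disc" for K
    using that assms by (intro uniform_limit_cong') auto
  then show ?thesis
    unfolding converges_locally_uniformly_def by blast
qed

section \<open>Convergence to the Denjoy--Wolff point\<close>

lemma converges_locally_uniformly_imp_tendsto:
  assumes "converges_locally_uniformly g h" "norm z < 1"
  shows "(\<lambda>n. g n z) \<longlonglongrightarrow> h z"
proof -
  have "uniform_limit {z} g h sequentially"
    using assms unfolding converges_locally_uniformly_def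
    by (metis compact_sing empty_subsetI insert_subset mem_ball_0)
  then show ?thesis
    by simp
qed

lemma denjoy_wolff_point_fixed:
  assumes f: "holomorphic_self_map f" and dw: "denjoy_wolff_point f \<zeta>" and \<zeta>: "norm \<zeta> < 1"
  shows "f \<zeta> = \<zeta>"
proof -
  have lim: "(\<lambda>n. (f ^^ n) \<zeta>) \<longlonglongrightarrow> \<zeta>"
    using converges_locally_uniformly_imp_tendsto dw \<zeta> unfolding denjoy_wolff_point_def by blast
  have "continuous_on unit_disc f"
    using f by (simp add: holomorphic_self_map_def holomorphic_on_imp_continuous_on)
  then have "isCont f \<zeta>"
    using \<zeta> by (simp add: continuous_on_eq_continuous_at)
  then have "(\<lambda>n. f ((f ^^ n) \<zeta>)) \<longlonglongrightarrow> f \<zeta>"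
    using lim by (rule isCont_tendsto_compose)
  moreover have "(\<lambda>n. f ((f ^^ n) \<zeta>)) \<longlonglongrightarrow> \<zeta>"
    using LIMSEQ_Suc[OF lim] by simp
  ultimately show ?thesis
    by (rule LIMSEQ_unique)
qed

theorem theorem3p3:
  fixes f :: "complex \<Rightarrow> complex" and fs :: "nat \<Rightarrow> complex \<Rightarrow> complex" and \<zeta> :: complex
  assumes "holomorphic_self_map f"
    and "denjoy_wolff_point f \<zeta>"
    and "\<zeta> \<in> unit_disc"
    and "\<And>n. n \<ge> 1 \<Longrightarrow> holomorphic_self_map (fs n)"
    and "converges_locally_uniformly fs f"
  shows "converges_locally_uniformly (left_composition fs) (\<lambda>_. \<zeta>)"
proof -
  note f = assms(1) and fs = assms(4)
  have \<zeta>: "norm \<zeta> < 1" "norm (- \<zeta>) < 1"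
    using assms(3) by auto
  let ?g = "moebius_conj \<zeta> f" and ?gs = "\<lambda>n. moebius_conj \<zeta> (fs n)"
  let ?F = "left_composition fs"
  have g: "holomorphic_self_map ?g"
    using \<zeta>(1) f by (rule holomorphic_self_map_moebius_conj)
  have gs: "holomorphic_self_map (?gs n)" if "n \<ge> 1" for n
    using \<zeta>(1) fs[OF that] by (rule holomorphic_self_map_moebius_conj)
  have const: "moebius_conj \<zeta> (\<lambda>_. \<zeta>) = (\<lambda>_. 0)" "moebius_conj (- \<zeta>) (\<lambda>_. 0) = (\<lambda>_. \<zeta>)"
    by (auto simp: moebius_conj_def Moebius_function_simple)
  have self: "h ` unit_disc \<subseteq> unit_disc" if "holomorphic_self_map h" for h
    using that by (simp add: holomorphic_self_map_def)
  have g0: "?g 0 = 0"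
    using denjoy_wolff_point_fixed[OF f assms(2) \<zeta>(1)]
    by (simp add: moebius_conj_def Moebius_function_simple)
  have "converges_locally_uniformly (\<lambda>n. moebius_conj \<zeta> (f ^^ n)) (\<lambda>_. 0)"
    unfolding const(1)[symmetric]
  proof (rule converges_locally_uniformly_moebius_conj[OF \<zeta>(1)])
    show "(f ^^ n) ` unit_disc \<subseteq> unit_disc" for n
      using holomorphic_self_map_left_composition[of "\<lambda>_. f" n] f
      by (simp add: left_composition_const self)
  qed (use assms(2,3) in \<open>auto simp: denjoy_wolff_point_def\<close>)
  \<comment> \<open>Iterates are the left compositions of a constant sequence, so they are conjugated likewise.\<close>
  moreover have "(?g ^^ n) z = moebius_conj \<zeta> (f ^^ n) z" if "norm z < 1" for n z
    using left_composition_moebius_conj[OF \<zeta>(1) that, of "\<lambda>_. f" n] f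
    by (simp add: left_composition_const)
  ultimately have iter: "(\<lambda>n. (?g ^^ n) z) \<longlonglongrightarrow> 0" if "norm z < 1" for z
    using converges_locally_uniformly_imp_tendsto that by fastforce
  have "converges_locally_uniformly ?gs ?g"
    using \<zeta>(1) self[OF fs] self[OF f] assms(5) by (rule converges_locally_uniformly_moebius_conj)
  then have "converges_locally_uniformly (left_composition ?gs) (\<lambda>_. 0)"
    by (intro left_composition_tendsto_0[OF g norm_less_if_iterates_tendsto_0[OF g g0 iter] g0 gs])
  then have "converges_locally_uniformly
      (\<lambda>n. moebius_conj (- \<zeta>) (left_composition ?gs n)) (\<lambda>_. \<zeta>)"
    unfolding const(2)[symmetric]
    by (rule converges_locally_uniformly_moebius_conj[OF \<zeta>(2), rotated 2])
      (use self[OF holomorphic_self_map_left_composition[of ?gs, OF gs]] in auto)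
  moreover have "moebius_conj (- \<zeta>) (left_composition ?gs n) z = ?F n z" if z: "norm z < 1" for n z
  proof -
    have "norm (Moebius_function 0 \<zeta> z) < 1"
      using \<zeta>(1) z by (rule Moebius_function_norm_lt_1)
    then have "moebius_conj (- \<zeta>) (left_composition ?gs n) z
        = moebius_conj (- \<zeta>) (moebius_conj \<zeta> (?F n)) z"
      using left_composition_moebius_conj[OF \<zeta>(1) _ fs] by (simp add: moebius_conj_def)
    then show ?thesis
      using moebius_conj_inverse[OF \<zeta>(1) z holomorphic_self_map_left_composition[of fs, OF fs]] by simp
  qed
  ultimately show ?thesis
    by (rule iffD1[OF converges_locally_uniformly_cong, rotated 2]) auto
qed

end
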